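(* Suppose that the sequence of path lengths $(T_n)_{n\ge 1}$ satisfies $T_n/n\to\infty$ and $T_n/n^2\to 0$ as $n\to\infty$. Then there exist constants $b, e_b>0$ independent of $n$ and an integer $n_0\ge 1$ such that for all $n\ge n_0$, $$\mathbb{P}\Big[\sigma_1(\hat N-N)>b\sqrt{\tfrac{T_n}{n}}\Big]\ \ge\ 1-\exp\Big(-e_b\tfrac{T_n}{n}\Big).$$ In particular, $\sigma_1(\hat N-N)=\Omega_{\mathbb{P}}(\sqrt{T_n/n})$.
   Context: Block Markov chain (BMC). Fix $K\ge1$, cluster ratios $\alpha=(\alpha_1,\dots,\alpha_K)$ with $\sum_k\alpha_k=1$ and $\min_k\alpha_k>0$, and a row-stochastic matrix $p=(p_{kl})_{k,l\in[K]}$ with $\min_{k,l}p_{kl}>0$ and $\mathrm{rank}(p)=K$; $\alpha,p,K$ do not depend on $n$. Write $[n]=\{1,\dots,n\}$. For each $n$ (large enough that all clusters are nonempty) the state space $[n]$ is partitioned into clusters $\mathcal V_1,\dots,\mathcal V_K$ with $|\mathcal V_k|=\lfloor n\alpha_k\rfloor$ for $k=2,\dots,K$ and $|\mathcal V_1|=n-\sum_{k=2}^K|\mathcal V_k|$; $\sigma:[n]\to[K]$ maps each state to the index of its cluster. The BMC $\{X_t\}_{t\ge0}$ is the homogeneous Markov chain on $[n]$ with transition matrix $P_{x,y}=p_{\sigma(x),\sigma(y)}/|\mathcal V_{\sigma(y)}|$; $\Pi$ denotes its unique stationary distribution, and $X_0$ has distribution $\Pi$. Given positive integers $T_n$, $\hat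 N$ is the random $n\times n$ matrix of transition counts $\hat N_{xy}=\sum_{t=0}^{T_n-1}\mathbf 1[X_t=x,X_{t+1}=y]$, and $N=\mathbb E[\hat N]$, i.e. $N_{xy}=T_n\Pi_xP_{x,y}$. $\sigma_1(A)\ge\sigma_2(A)\ge\cdots$ denote the singular values of a matrix $A$ (not to be confused with the cluster map $\sigma$), so $\sigma_1$ is the spectral norm. For random sequences, $X_n=O_{\mathbb P}(Y_n)$ means: for every $\epsilon>0$ there are $C_\epsilon,n_\epsilon>0$ with $\mathbb P[|X_n/Y_n|>C_\epsilon]\le\epsilon$ for all $n>n_\epsilon$; $X_n=\Omega_{\mathbb P}(Y_n)$ means $Y_n=O_{\mathbb P}(X_n)$, i.e. for every $\epsilon>0$ there are $c_\epsilon,n_\epsilon>0$ with $\mathbb P[|X_n|<c_\epsilon|Y_n|]\le\epsilon$ for all $n>n_\epsilon$. *)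

theory Defs
  imports
    "HOL-Probability.Probability"
    "Jordan_Normal_Form.DL_Rank"
    "Jordan_Normal_Form.Char_Poly"
begin

text \<open>
  Matrices are those of \<^theory>\<open>Jordan_Normal_Form.Matrix\<close>, whose indices start at 0. The state
  space \<open>[n]\<close> is therefore \<open>{..<n}\<close>, and the clusters are numbered \<open>0, \<dots>, K - 1\<close>;
  cluster \<open>0\<close> is the one that absorbs the rounding.
\<close>

definition cluster :: "nat \<Rightarrow> (nat \<Rightarrow> nat) \<Rightarrow> nat \<Rightarrow> nat set" where
  "cluster n \<sigma> k = {x. x < n \<and> \<sigma> x = k}"

text \<open>
  The subtraction below does not truncate when the ratios are nonnegative and sum to 1.
\<close>

definition cluster_size :: "nat \<Rightarrow> (nat \<Rightarrow> real) \<Rightarrow> nat \<Rightarrow> nat \<Rightarrow> nat" where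
  "cluster_size K \<alpha> n k =
     (if k = 0 then n - (\<Sum>l = 1..<K. nat \<lfloor>real n * \<alpha> l\<rfloor>) else nat \<lfloor>real n * \<alpha> k\<rfloor>)"

definition cluster_map :: "nat \<Rightarrow> (nat \<Rightarrow> real) \<Rightarrow> nat \<Rightarrow> (nat \<Rightarrow> nat) \<Rightarrow> bool" where
  "cluster_map K \<alpha> n \<sigma> \<longleftrightarrow>
     (\<forall>x<n. \<sigma> x < K) \<and> (\<forall>k<K. card (cluster n \<sigma> k) = cluster_size K \<alpha> n k)"

definition bmc_matrix :: "real mat \<Rightarrow> nat \<Rightarrow> (nat \<Rightarrow> nat) \<Rightarrow> real mat" where
  "bmc_matrix p n \<sigma> =
     Matrix.mat n n (\<lambda>(x, y). p $$ (\<sigma> x, \<sigma> y) / real (card (cluster n \<sigma> (\<sigma> y))))"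

definition stationary_distribution :: "nat \<Rightarrow> real mat \<Rightarrow> (nat \<Rightarrow> real) \<Rightarrow> bool" where
  "stationary_distribution n P \<mu> \<longleftrightarrow>
     (\<forall>x<n. 0 \<le> \<mu> x) \<and> (\<Sum>x<n. \<mu> x) = 1 \<and> (\<forall>y<n. (\<Sum>x<n. \<mu> x * P $$ (x, y)) = \<mu> y)"

definition markov_chain ::
    "'a measure \<Rightarrow> nat \<Rightarrow> (nat \<Rightarrow> real) \<Rightarrow> real mat \<Rightarrow> (nat \<Rightarrow> 'a \<Rightarrow> nat) \<Rightarrow> bool" where
  "markov_chain M n \<mu> P X \<longleftrightarrow>
     prob_space M \<and>
     (\<forall>t. X t \<in> measurable M (count_space {..<n})) \<and>
     (\<forall>x<n. \<P>(\<omega> in M. X 0 \<omega> = x) = \<mu> x) \<and>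
     (\<forall>t x y. (\<forall>s\<le>t. x s < n) \<longrightarrow> y < n \<longrightarrow> \<P>(\<omega> in M. \<forall>s\<le>t. X s \<omega> = x s) > 0 \<longrightarrow>
        \<P>(\<omega> in M. X (Suc t) \<omega> = y \<bar> \<forall>s\<le>t. X s \<omega> = x s) = P $$ (x t, y))"

definition block_markov_chain ::
    "nat \<Rightarrow> (nat \<Rightarrow> real) \<Rightarrow> real mat \<Rightarrow> nat \<Rightarrow> (nat \<Rightarrow> nat) \<Rightarrow> (nat \<Rightarrow> real) \<Rightarrow>
     'a measure \<Rightarrow> (nat \<Rightarrow> 'a \<Rightarrow> nat) \<Rightarrow> bool" where
  "block_markov_chain K \<alpha> p n \<sigma> \<mu> M X \<longleftrightarrow>
     cluster_map K \<alpha> n \<sigma> \<and>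
     stationary_distribution n (bmc_matrix p n \<sigma>) \<mu> \<and>
     markov_chain M n \<mu> (bmc_matrix p n \<sigma>) X"

definition count_matrix :: "nat \<Rightarrow> nat \<Rightarrow> (nat \<Rightarrow> 'a \<Rightarrow> nat) \<Rightarrow> 'a \<Rightarrow> real mat" where
  "count_matrix n T X \<omega> =
     Matrix.mat n n (\<lambda>(x, y). \<Sum>t<T. of_bool (X t \<omega> = x \<and> X (Suc t) \<omega> = y))"

definition mean_count_matrix ::
    "'a measure \<Rightarrow> nat \<Rightarrow> nat \<Rightarrow> (nat \<Rightarrow> 'a \<Rightarrow> nat) \<Rightarrow> real mat" where
  "mean_count_matrix M n T X =
     Matrix.mat n n (\<lambda>(x, y). integral\<^sup>L M (\<lambda>\<omega>. count_matrix n T X \<omega> $$ (x, y)))"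

text \<open>
  Singular values are the square roots of the eigenvalues of \<open>A\<^sup>T A\<close>, counted with
  multiplicity and listed in decreasing order; as usual their numbering starts at 1.
\<close>

definition singular_values :: "real mat \<Rightarrow> real list" where
  "singular_values A =
     rev (sorted_list_of_multiset
       (image_mset sqrt (proots (char_poly (transpose_mat A * A)))))"

definition singular_value :: "nat \<Rightarrow> real mat \<Rightarrow> real" where
  "singular_value i A = singular_values A ! (i - 1)"

text \<open>
  \<open>Z n = \<Omega>\<^sub>P(Y n)\<close>, in the form that does not divide by \<open>Z n\<close>, which may vanish.
\<close>

definition Omega_P ::
    "(nat \<Rightarrow> 'a measure) \<Rightarrow> (nat \<Rightarrow> 'a \<Rightarrow> real) \<Rightarrow> (nat \<Rightarrow> 'a \<Rightarrow> real) \<Rightarrow> bool" where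
  "Omega_P M Z Y \<longleftrightarrow>
     (\<forall>\<epsilon>>0. \<exists>c>0. \<exists>n\<^sub>0>0. \<forall>n>n\<^sub>0. \<P>(\<omega> in M n. \<bar>Z n \<omega>\<bar> < c * \<bar>Y n \<omega>\<bar>) \<le> \<epsilon>)"

end

theory Submission
  imports Defs "Jordan_Normal_Form.Schur_Decomposition"
begin

text \<open>
  The lower bound is deterministic: for all large \<open>n\<close> it holds at every sample point, so the event
  has probability 1. Write \<open>C\<close> for the count matrix and \<open>N\<close> for its mean.

  The squared Frobenius norm of a matrix \<open>A\<close> is the trace of \<open>A\<^sup>T A\<close>, hence at most \<open>n\<close> times the
  largest eigenvalue of \<open>A\<^sup>T A\<close> (lemma \<open>frobenius_le_singular_value_1\<close>). It is therefore enough to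
  show that the squared Frobenius norm of \<open>C - N\<close> is at least \<open>T / 2\<close>.

  The entries of \<open>C\<close> are nonnegative integers with sum \<open>T\<close>. Since an integer is at most its square,
  the sum of \<open>(C - N)\<^sup>2\<close> over all entries is at least the sum of \<open>C - 2 C N\<close>, which is at least
  \<open>T (1 - 2 m)\<close> if all entries of \<open>N\<close> are at most \<open>m\<close> (lemma \<open>frobenius_count_minus_mean_ge\<close>).

  Finally \<open>N\<close> has entries \<open>T \<mu>(x) P(x, y)\<close> (lemma \<open>mean_count_matrix_entry\<close>). All clusters grow
  linearly in \<open>n\<close>, so the entries of \<open>P\<close>, and with them those of its stationary distribution
  \<open>\<mu>\<close>, are of order \<open>1 / n\<close>. Hence \<open>m\<close> is of order \<open>T / n\<^sup>2\<close>, which tends to 0, and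
  \<open>m \<le> 1 / 4\<close> for large \<open>n\<close>.
\<close>

section \<open>The largest singular value and the Frobenius norm\<close>

lemma trace_similar:
  fixes A B :: "'a :: comm_ring_1 mat"
  assumes A: "A \<in> carrier_mat n n" and sim: "similar_mat A B"
  shows "(\<Sum>i<n. A $$ (i, i)) = (\<Sum>i<n. B $$ (i, i))"
proof -
  from similar_matD[OF sim] A obtain P Q where
    c: "{A, B, P, Q} \<subseteq> carrier_mat n n" and QP: "Q * P = 1\<^sub>m n" and AB: "A = P * B * Q"
    by (metis carrier_matD(1) insert_subset)
  have entry: "(E * F) $$ (i, j) = (\<Sum>k<n. E $$ (i, k) * F $$ (k, j))"
    if "E \<in> carrier_mat n n" "F \<in> carrier_mat n n" "i < n" "j < n" for E F :: "'a mat" and i j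
    using that by (simp add: scalar_prod_def lessThan_atLeast0)
  have comm: "(\<Sum>i<n. (E * F) $$ (i, i)) = (\<Sum>i<n. (F * E) $$ (i, i))"
    if "E \<in> carrier_mat n n" "F \<in> carrier_mat n n" for E F :: "'a mat"
  proof -
    have "(\<Sum>i<n. (E * F) $$ (i, i)) = (\<Sum>i<n. \<Sum>k<n. E $$ (i, k) * F $$ (k, i))"
      using that by (intro sum.cong refl entry) auto
    also have "\<dots> = (\<Sum>k<n. \<Sum>i<n. F $$ (k, i) * E $$ (i, k))"
      by (subst sum.swap) (simp add: mult.commute)
    also have "\<dots> = (\<Sum>k<n. (F * E) $$ (k, k))"
      using that by (intro sum.cong refl entry[symmetric]) auto
    finally show ?thesis .
  qed
  have "(\<Sum>i<n. A $$ (i, i)) = (\<Sum>i<n. (Q * (P * B)) $$ (i, i))"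
    unfolding AB using c by (intro comm) auto
  also have "Q * (P * B) = (Q * P) * B"
    using c by (intro assoc_mult_mat[symmetric]) auto
  also have "\<dots> = B" unfolding QP using c by (intro left_mult_one_mat) auto
  finally show ?thesis .
qed

lemma symmetric_eigenvalue_real:
  fixes B :: "real mat"
  assumes B: "B \<in> carrier_mat n n"
    and sym: "\<And>i j. i < n \<Longrightarrow> j < n \<Longrightarrow> B $$ (i, j) = B $$ (j, i)"
    and ev: "eigenvalue (map_mat complex_of_real B) z"
  shows "z \<in> \<real>"
proof -
  from ev obtain v where v: "v \<in> carrier_vec n" "v \<noteq> 0\<^sub>v n"
    and eq: "map_mat complex_of_real B *\<^sub>v v = z \<cdot>\<^sub>v v"
    using B unfolding eigenvalue_def eigenvector_def by auto
  define f where "f i = vec_index v i" for i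
  have row: "(\<Sum>j<n. of_real (B $$ (i, j)) * f j) = z * f i" if "i < n" for i
  proof -
    have "vec_index (map_mat complex_of_real B *\<^sub>v v) i = z * f i"
      unfolding eq f_def using that v by simp
    thus ?thesis using that B v
      by (simp add: scalar_prod_def lessThan_atLeast0 f_def)
  qed
  \<comment> \<open>the Hermitian form of \<open>B\<close> at the eigenvector; it is real, and equals \<open>z\<close> times a norm\<close>
  define S where "S = (\<Sum>i<n. \<Sum>j<n. cnj (f i) * of_real (B $$ (i, j)) * f j)"
  define r where "r = (\<Sum>i<n. (cmod (f i))\<^sup>2)"
  have S: "S = z * of_real r"
  proof -
    have "S = (\<Sum>i<n. cnj (f i) * (\<Sum>j<n. of_real (B $$ (i, j)) * f j))"
      unfolding S_def by (simp add: sum_distrib_left mult.assoc)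
    also have "\<dots> = (\<Sum>i<n. z * (f i * cnj (f i)))"
      by (rule sum.cong) (auto simp: row)
    also have "\<dots> = z * of_real r"
      unfolding r_def by (simp add: sum_distrib_left complex_norm_square[symmetric])
    finally show ?thesis .
  qed
  have "cnj S = (\<Sum>i<n. \<Sum>j<n. f i * of_real (B $$ (j, i)) * cnj (f j))"
    unfolding S_def by (auto intro!: sum.cong simp: sym)
  also have "\<dots> = S"
    unfolding S_def by (subst sum.swap) (auto intro!: sum.cong)
  finally have "S \<in> \<real>" by (simp add: Reals_cnj_iff)
  moreover have "r \<noteq> 0"
  proof
    assume "r = 0"
    hence "\<forall>i<n. f i = 0" unfolding r_def by (subst (asm) sum_nonneg_eq_0_iff) auto
    hence "v = 0\<^sub>v n" using v by (intro eq_vecI) (auto simp: f_def)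
    with v show False by simp
  qed
  moreover have "z = S / of_real r" using S \<open>r \<noteq> 0\<close> by simp
  ultimately show ?thesis by simp
qed

text \<open>
  The largest eigenvalue of a real symmetric matrix is at least the mean of its diagonal. The
  complexified matrix is similar to an upper triangular one, whose diagonal entries are the
  eigenvalues and are all real; their mean is the mean of the original diagonal, so one of them
  is at least that mean.
\<close>

lemma symmetric_char_poly_root_ge_mean_trace:
  fixes B :: "real mat"
  assumes B: "B \<in> carrier_mat n n" and n: "n > 0"
    and sym: "\<And>i j. i < n \<Longrightarrow> j < n \<Longrightarrow> B $$ (i, j) = B $$ (j, i)"
  obtains r where "poly (char_poly B) r = 0" "(\<Sum>i<n. B $$ (i, i)) \<le> real n * r"
proof -
  let ?C = "map_mat complex_of_real B"
  have C: "?C \<in> carrier_mat n n" using B by simp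
  from char_poly_factorized[OF C] obtain es where
    "char_poly ?C = (\<Prod>a\<leftarrow>es. [:- a, 1:])" by blast
  from schur_decomposition_exists[OF C this] obtain U where
    U: "U \<in> carrier_mat n n" "upper_triangular U" and sim: "similar_mat ?C U" by blast
  have eig: "eigenvalue ?C (U $$ (i, i))" if "i < n" for i
  proof -
    have "char_poly ?C = (\<Prod>a\<leftarrow>diag_mat U. [:- a, 1:])"
      using char_poly_similar[OF sim] char_poly_upper_triangular[OF U] by simp
    moreover have "U $$ (i, i) \<in> set (diag_mat U)"
      using that U by (auto simp: diag_mat_def)
    ultimately have "poly (char_poly ?C) (U $$ (i, i)) = 0"
      by (auto simp: poly_prod_list prod_list_zero_iff image_iff)
    thus ?thesis using eigenvalue_root_char_poly[OF C] by simp
  qed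
  have root: "poly (char_poly B) (Re (U $$ (i, i))) = 0" if "i < n" for i
  proof -
    have "U $$ (i, i) \<in> \<real>"
      using symmetric_eigenvalue_real[OF B sym eig[OF that]] by blast
    hence "of_real (Re (U $$ (i, i))) = U $$ (i, i)" by simp
    hence "poly (char_poly ?C) (of_real (Re (U $$ (i, i)))) = 0"
      using eig[OF that] eigenvalue_root_char_poly[OF C] by simp
    also have "char_poly ?C = map_poly of_real (char_poly B)"
      by (rule of_real_hom.char_poly_hom[OF B])
    finally show ?thesis by simp
  qed
  have "(\<Sum>i<n. ?C $$ (i, i)) = (\<Sum>i<n. U $$ (i, i))"
    by (rule trace_similar[OF C sim])
  moreover have "(\<Sum>i<n. ?C $$ (i, i)) = of_real (\<Sum>i<n. B $$ (i, i))"
    using B by simp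
  ultimately have tr: "(\<Sum>i<n. B $$ (i, i)) = (\<Sum>i<n. Re (U $$ (i, i)))"
    by (metis Re_complex_of_real Re_sum)
  have "\<exists>i<n. (\<Sum>i<n. B $$ (i, i)) \<le> real n * Re (U $$ (i, i))"
  proof (rule ccontr)
    assume "\<not> ?thesis"
    hence "(\<Sum>i<n. Re (U $$ (i, i))) < (\<Sum>i<n. (\<Sum>i<n. B $$ (i, i)) / real n)"
      using n by (intro sum_strict_mono) (auto simp: field_simps not_le)
    thus False using tr n by simp
  qed
  with root that show thesis by blast
qed

lemma singular_value_1_ge:
  assumes A: "A \<in> carrier_mat n n" and r: "poly (char_poly (transpose_mat A * A)) r = 0"
  shows "sqrt r \<le> singular_value 1 A"
proof -
  let ?q = "char_poly (transpose_mat A * A)"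
  have "transpose_mat A * A \<in> carrier_mat n n" using A by simp
  from degree_monic_char_poly[OF this] have "?q \<noteq> 0" by auto
  define L where "L = sorted_list_of_multiset (image_mset sqrt (proots ?q))"
  have "sqrt r \<in> set L" using r \<open>?q \<noteq> 0\<close> by (simp add: L_def)
  then obtain i where i: "i < length L" "L ! i = sqrt r" by (auto simp: in_set_conv_nth)
  have "sorted L" by (simp add: L_def)
  with i have "sqrt r \<le> L ! (length L - 1)"
    using sorted_nth_mono[of L i "length L - 1"] by auto
  also have "\<dots> = singular_value 1 A"
    unfolding singular_value_def singular_values_def L_def[symmetric] using i
    by (subst rev_nth) auto
  finally show ?thesis .
qed

lemma frobenius_le_singular_value_1:
  assumes A: "A \<in> carrier_mat n n" and n: "n > 0"
  shows "sqrt ((\<Sum>x<n. \<Sum>y<n. (A $$ (x, y))\<^sup>2) / real n) \<le> singular_value 1 A"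
proof -
  let ?B = "transpose_mat A * A"
  have B: "?B \<in> carrier_mat n n" using A by simp
  have entry: "?B $$ (i, j) = (\<Sum>x<n. A $$ (x, i) * A $$ (x, j))" if "i < n" "j < n" for i j
    using that A by (simp add: scalar_prod_def lessThan_atLeast0)
  obtain r where r: "poly (char_poly ?B) r = 0" "(\<Sum>i<n. ?B $$ (i, i)) \<le> real n * r"
    by (rule symmetric_char_poly_root_ge_mean_trace[OF B n]) (auto simp: entry mult.commute)
  have "(\<Sum>i<n. ?B $$ (i, i)) = (\<Sum>x<n. \<Sum>y<n. (A $$ (x, y))\<^sup>2)"
    by (subst sum.swap) (simp add: entry power2_eq_square)
  with r n have "(\<Sum>x<n. \<Sum>y<n. (A $$ (x, y))\<^sup>2) / real n \<le> r" by (simp add: field_simps)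
  thus ?thesis using singular_value_1_ge[OF A r(1)] real_sqrt_le_mono order_trans by blast
qed

section \<open>Cluster sizes\<close>

lemma cluster_size_lower_bound:
  assumes \<alpha>: "\<And>k. k < K \<Longrightarrow> \<alpha> k > 0" and sum1: "(\<Sum>k<K. \<alpha> k) = 1" and k: "k < K"
  shows "real n * \<alpha> k - 1 \<le> real (cluster_size K \<alpha> n k)"
proof (cases "k = 0")
  case False
  thus ?thesis using \<alpha>[OF k] unfolding cluster_size_def by simp
next
  case True
  let ?s = "\<Sum>l = 1..<K. nat \<lfloor>real n * \<alpha> l\<rfloor>"
  have "real ?s \<le> (\<Sum>l = 1..<K. real n * \<alpha> l)"
    unfolding of_nat_sum using \<alpha> by (intro sum_mono) (simp add: less_imp_le)
  also have "\<dots> = real n * ((\<Sum>k<K. \<alpha> k) - \<alpha> 0)"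
    using k True by (simp add: lessThan_atLeast0 sum.atLeast_Suc_lessThan sum_distrib_left)
  finally have "real n * \<alpha> 0 \<le> real n - real ?s"
    using sum1 by (simp add: right_diff_distrib)
  also have "\<dots> \<le> real (n - ?s)" by linarith
  finally show ?thesis using True by (simp add: cluster_size_def)
qed

lemma cluster_size_linear_lower_bound:
  assumes K: "K \<ge> 1" and \<alpha>: "\<And>k. k < K \<Longrightarrow> \<alpha> k > 0" and sum1: "(\<Sum>k<K. \<alpha> k) = 1"
  obtains c where "c > 0"
    "eventually (\<lambda>n. \<forall>k<K. c * real n \<le> real (cluster_size K \<alpha> n k)) sequentially"
proof -
  define a where "a = Min (\<alpha> ` {..<K})"
  have ne: "\<alpha> ` {..<K} \<noteq> {}" using K by (auto simp: lessThan_empty_iff)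
  have a: "a > 0" using \<alpha> ne by (simp add: a_def)
  have "a / 2 * real n \<le> real (cluster_size K \<alpha> n k)" if "real n \<ge> 2 / a" "k < K" for n k
  proof -
    have "a * real n \<le> \<alpha> k * real n"
      using that by (intro mult_right_mono) (auto simp: a_def)
    moreover have "a * real n \<ge> 2" using that a by (simp add: field_simps)
    ultimately have "a / 2 * real n \<le> real n * \<alpha> k - 1" by (simp add: mult.commute)
    also have "\<dots> \<le> real (cluster_size K \<alpha> n k)"
      by (rule cluster_size_lower_bound[OF \<alpha> sum1 that(2)])
    finally show ?thesis .
  qed
  moreover have "eventually (\<lambda>n. real n \<ge> 2 / a) sequentially"
    by (rule eventually_compose_filterlim[OF eventually_ge_at_top filterlim_real_sequentially])
  ultimately have "eventually (\<lambda>n. \<forall>k<K. a / 2 * real n \<le> real (cluster_size K \<alpha> n k)) sequentially"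
    by (blast intro: eventually_mono)
  thus thesis using a by (intro that[of "a / 2"]) auto
qed

section \<open>Marginals of a stationary Markov chain and the mean counts\<close>

lemma markov_chain_measurable_state:
  assumes "markov_chain M n \<mu> P X"
  shows "Measurable.pred M (\<lambda>\<omega>. X t \<omega> = x)"
proof -
  have X: "X t \<in> measurable M (count_space {..<n})"
    using assms by (simp add: markov_chain_def)
  have "{\<omega> \<in> space M. X t \<omega> = x} = X t -` ({x} \<inter> {..<n}) \<inter> space M"
    using measurable_space[OF X] by auto
  thus ?thesis unfolding pred_def using measurable_sets[OF X, of "{x} \<inter> {..<n}"] by simp
qed

lemma markov_chain_less:
  assumes "markov_chain M n \<mu> P X" "\<omega> \<in> space M"
  shows "X t \<omega> < n"
  using assms measurable_space[of "X t" M "count_space {..<n}" \<omega>] by (simp add: markov_chain_def)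

text \<open>
  The definition of a Markov chain conditions on complete histories of positive probability. The
  event \<open>X t = x\<close> is the disjoint union of the histories that end in \<open>x\<close>, so summing over
  them removes the conditioning on the past and the positivity condition.
\<close>

lemma markov_chain_pair_prob:
  assumes mc: "markov_chain M n \<mu> P X" and x: "x < n" and y: "y < n"
  shows "\<P>(\<omega> in M. X t \<omega> = x \<and> X (Suc t) \<omega> = y) = \<P>(\<omega> in M. X t \<omega> = x) * P $$ (x, y)"
proof -
  interpret prob_space M using mc by (simp add: markov_chain_def)
  note Xlt = markov_chain_less[OF mc]
  note [measurable] = markov_chain_measurable_state[OF mc]
  define H where "H = {h \<in> {..t} \<rightarrow>\<^sub>E {..<n}. h t = x}"
  have finH: "finite H" unfolding H_def
    by (rule finite_subset[OF _ finite_PiE[of "{..t}" "\<lambda>_. {..<n}"]]) auto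
  define E where "E h = {\<omega> \<in> space M. \<forall>s\<le>t. X s \<omega> = h s}" for h
  define F where "F = {\<omega> \<in> space M. X (Suc t) \<omega> = y}"
  have E_sets: "E h \<in> events" for h unfolding E_def by measurable
  have F_sets: "F \<in> events" unfolding F_def by measurable
  have disj: "disjoint_family_on E H"
  proof (unfold disjoint_family_on_def, intro ballI impI)
    fix g h assume "g \<in> H" "h \<in> H" "g \<noteq> h"
    then obtain s where "s \<le> t" "g s \<noteq> h s" unfolding H_def by (metis (lifting) PiE_ext atMost_iff mem_Collect_eq)
    thus "E g \<inter> E h = {}" by (auto simp: E_def)
  qed
  have U: "{\<omega> \<in> space M. X t \<omega> = x} = (\<Union>h\<in>H. E h)"
  proof (intro equalityI subsetI)
    fix \<omega> assume w: "\<omega> \<in> {\<omega> \<in> space M. X t \<omega> = x}"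
    hence "restrict (\<lambda>s. X s \<omega>) {..t} \<in> H" by (auto simp: H_def Xlt)
    moreover have "\<omega> \<in> E (restrict (\<lambda>s. X s \<omega>) {..t})" using w by (auto simp: E_def)
    ultimately show "\<omega> \<in> (\<Union>h\<in>H. E h)" by blast
  qed (auto simp: E_def H_def)
  have step: "prob (E h \<inter> F) = prob (E h) * P $$ (x, y)" if h: "h \<in> H" for h
  proof (cases "prob (E h) > 0")
    case True
    have "\<forall>s\<le>t. h s < n" using h by (auto simp: H_def)
    with mc y True have "cond_prob M (\<lambda>\<omega>. X (Suc t) \<omega> = y) (\<lambda>\<omega>. \<forall>s\<le>t. X s \<omega> = h s) = P $$ (h t, y)"
      unfolding markov_chain_def E_def by blast
    moreover have "{\<omega> \<in> space M. X (Suc t) \<omega> = y \<and> (\<forall>s\<le>t. X s \<omega> = h s)} = E h \<inter> F"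
      by (auto simp: E_def F_def)
    ultimately show ?thesis using True h
      by (simp add: cond_prob_def E_def[symmetric] H_def field_simps)
  next
    case False
    hence "prob (E h) = 0" using measure_nonneg[of M "E h"] by linarith
    moreover have "prob (E h \<inter> F) \<le> prob (E h)"
      by (rule finite_measure_mono) (auto simp: E_sets)
    ultimately show ?thesis using measure_nonneg[of M "E h \<inter> F"] by simp
  qed
  have "{\<omega> \<in> space M. X t \<omega> = x \<and> X (Suc t) \<omega> = y} = (\<Union>h\<in>H. E h \<inter> F)"
    using U by (auto simp: F_def)
  also have "prob \<dots> = (\<Sum>h\<in>H. prob (E h \<inter> F))"
    using finH E_sets F_sets disj
    by (intro finite_measure_finite_Union) (auto simp: disjoint_family_on_def)
  also have "\<dots> = (\<Sum>h\<in>H. prob (E h)) * P $$ (x, y)"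
    by (simp add: step sum_distrib_right)
  also have "(\<Sum>h\<in>H. prob (E h)) = prob (\<Union>h\<in>H. E h)"
    using finH E_sets disj by (intro finite_measure_finite_Union[symmetric]) auto
  finally show ?thesis unfolding U by simp
qed

lemma stationary_distribution_le:
  assumes st: "stationary_distribution n P \<mu>"
    and q: "\<And>x y. x < n \<Longrightarrow> y < n \<Longrightarrow> P $$ (x, y) \<le> q" and y: "y < n"
  shows "\<mu> y \<le> q"
proof -
  have "\<mu> y = (\<Sum>x<n. \<mu> x * P $$ (x, y))"
    using st y by (simp add: stationary_distribution_def)
  also have "\<dots> \<le> (\<Sum>x<n. \<mu> x * q)"
    using st q y by (intro sum_mono mult_left_mono) (auto simp: stationary_distribution_def)
  also have "\<dots> = q"
    using st by (simp add: stationary_distribution_def sum_distrib_right[symmetric])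
  finally show ?thesis .
qed

lemma stationary_chain_prob:
  assumes mc: "markov_chain M n \<mu> P X" and st: "stationary_distribution n P \<mu>" and x: "x < n"
  shows "\<P>(\<omega> in M. X t \<omega> = x) = \<mu> x"
  using x
proof (induction t arbitrary: x)
  case 0
  thus ?case using mc by (simp add: markov_chain_def)
next
  case (Suc t y)
  interpret prob_space M using mc by (simp add: markov_chain_def)
  note [measurable] = markov_chain_measurable_state[OF mc]
  have "{\<omega> \<in> space M. X (Suc t) \<omega> = y} = (\<Union>x<n. {\<omega> \<in> space M. X t \<omega> = x \<and> X (Suc t) \<omega> = y})"
    using markov_chain_less[OF mc] by auto
  also have "prob \<dots> = (\<Sum>x<n. \<P>(\<omega> in M. X t \<omega> = x \<and> X (Suc t) \<omega> = y))"
    by (intro finite_measure_finite_Union) (auto simp: disjoint_family_on_def)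
  also have "\<dots> = (\<Sum>x<n. \<mu> x * P $$ (x, y))"
    using Suc by (simp add: markov_chain_pair_prob[OF mc])
  also have "\<dots> = \<mu> y" using st Suc.prems by (simp add: stationary_distribution_def)
  finally show ?case .
qed

lemma mean_count_matrix_entry:
  assumes mc: "markov_chain M n \<mu> P X" and st: "stationary_distribution n P \<mu>"
    and x: "x < n" and y: "y < n"
  shows "mean_count_matrix M n T X $$ (x, y) = real T * \<mu> x * P $$ (x, y)"
proof -
  interpret prob_space M using mc by (simp add: markov_chain_def)
  note [measurable] = markov_chain_measurable_state[OF mc]
  let ?S = "\<lambda>t. {\<omega> \<in> space M. X t \<omega> = x \<and> X (Suc t) \<omega> = y}"
  have "mean_count_matrix M n T X $$ (x, y)
      = (\<integral>\<omega>. (\<Sum>t<T. of_bool (X t \<omega> = x \<and> X (Suc t) \<omega> = y)) \<partial>M)"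
    using x y by (simp add: mean_count_matrix_def count_matrix_def)
  also have "\<dots> = (\<integral>\<omega>. (\<Sum>t<T. indicator (?S t) \<omega>) \<partial>M)"
    by (intro Bochner_Integration.integral_cong sum.cong) (auto simp: indicator_def)
  also have "\<dots> = (\<Sum>t<T. \<integral>\<omega>. indicator (?S t) \<omega> \<partial>M)"
    by (intro Bochner_Integration.integral_sum)
      (simp add: integrable_indicator_iff emeasure_finite less_top[symmetric])
  also have "\<dots> = (\<Sum>t<T. prob (?S t))" by (simp add: Int_absorb2)
  also have "\<dots> = real T * \<mu> x * P $$ (x, y)"
    using x y by (simp add: markov_chain_pair_prob[OF mc] stationary_chain_prob[OF mc st])
  finally show ?thesis .
qed

section \<open>Counts minus their mean\<close>

lemma sum_count_matrix:
  assumes "\<And>t. X t \<omega> < n"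
  shows "(\<Sum>x<n. \<Sum>y<n. count_matrix n T X \<omega> $$ (x, y)) = real T"
proof -
  have "(\<Sum>x<n. \<Sum>y<n. count_matrix n T X \<omega> $$ (x, y))
      = (\<Sum>x<n. \<Sum>y<n. \<Sum>t<T. of_bool (X t \<omega> = x) * of_bool (X (Suc t) \<omega> = y))"
    by (simp add: count_matrix_def of_bool_conj)
  also have "\<dots> = (\<Sum>x<n. \<Sum>t<T. \<Sum>y<n. of_bool (X t \<omega> = x) * of_bool (X (Suc t) \<omega> = y))"
    by (intro sum.cong refl sum.swap)
  also have "\<dots> = (\<Sum>t<T. \<Sum>x<n. \<Sum>y<n. of_bool (X t \<omega> = x) * of_bool (X (Suc t) \<omega> = y))"
    by (rule sum.swap)
  also have "\<dots> = (\<Sum>t<T. (\<Sum>x<n. of_bool (X t \<omega> = x)) * (\<Sum>y<n. of_bool (X (Suc t) \<omega> = y)))"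
    unfolding sum_product ..
  also have "\<dots> = real T"
    using assms by (simp add: of_bool_def)
  finally show ?thesis .
qed

text \<open>
  The pointwise lower bound on the Frobenius norm. It holds for any matrix \<open>N\<close> with entries at
  most \<open>m\<close>, for every path: with integer counts \<open>c\<close> that sum to \<open>T\<close>, the bound
  \<open>(c - N)\<^sup>2 \<ge> c\<^sup>2 - 2 c N \<ge> c (1 - 2 m)\<close> can be summed over all entries.
\<close>

lemma frobenius_count_minus_mean_ge:
  assumes X: "\<And>t. X t \<omega> < n" and N: "N \<in> carrier_mat n n"
    and m: "\<And>x y. x < n \<Longrightarrow> y < n \<Longrightarrow> N $$ (x, y) \<le> m"
  shows "real T * (1 - 2 * m) \<le> (\<Sum>x<n. \<Sum>y<n. ((count_matrix n T X \<omega> - N) $$ (x, y))\<^sup>2)"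
proof -
  let ?C = "count_matrix n T X \<omega>"
  have "real T * (1 - 2 * m) = (\<Sum>x<n. \<Sum>y<n. ?C $$ (x, y) * (1 - 2 * m))"
    unfolding sum_count_matrix[where X = X and \<omega> = \<omega> and T = T, OF X, symmetric]
    by (simp add: sum_distrib_right)
  also have "\<dots> \<le> (\<Sum>x<n. \<Sum>y<n. ((?C - N) $$ (x, y))\<^sup>2)"
  proof (intro sum_mono)
    fix x y assume "x \<in> {..<n}" "y \<in> {..<n}"
    hence xy: "x < n" "y < n" by auto
    define c where "c = (\<Sum>t<T. of_bool (X t \<omega> = x \<and> X (Suc t) \<omega> = y) :: nat)"
    have c: "?C $$ (x, y) = real c" using xy by (simp add: count_matrix_def c_def)
    \<comment> \<open>the only place where integrality of the counts enters: an integer is at most its square\<close>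
    have "real c \<le> (real c)\<^sup>2" by (cases c) (auto simp: power2_eq_square)
    moreover have "real c * N $$ (x, y) \<le> real c * m" using m[OF xy] by (simp add: mult_left_mono)
    moreover have "(real c - N $$ (x, y))\<^sup>2
        = (real c)\<^sup>2 - 2 * (real c * N $$ (x, y)) + (N $$ (x, y))\<^sup>2"
      by (simp add: power2_diff)
    ultimately have "real c * (1 - 2 * m) \<le> (real c - N $$ (x, y))\<^sup>2"
      using zero_le_power2[of "N $$ (x, y)"] right_diff_distrib[of "real c" 1 "2 * m"] by linarith
    thus "?C $$ (x, y) * (1 - 2 * m) \<le> ((?C - N) $$ (x, y))\<^sup>2"
      using xy N c by (simp add: count_matrix_def)
  qed
  finally show ?thesis .
qed

text \<open>
  If all clusters have at least \<open>c n\<close> states, then the transition matrix and the stationary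
  distribution have entries at most \<open>1 / (c n)\<close>, so every mean count is at most
  \<open>T / (c n)\<^sup>2\<close>. The hypothesis on \<open>T\<close> makes this at most \<open>1 / 4\<close>.
\<close>

lemma singular_value_count_minus_mean_ge:
  assumes bmc: "block_markov_chain K \<alpha> p n \<sigma> \<mu> M X" and n: "n > 0"
    and p: "\<And>k l. k < K \<Longrightarrow> l < K \<Longrightarrow> p $$ (k, l) \<in> {0..1}"
    and c: "c > 0" and size: "\<And>k. k < K \<Longrightarrow> c * real n \<le> real (cluster_size K \<alpha> n k)"
    and T: "4 * real T \<le> (c * real n)\<^sup>2"
    and \<omega>: "\<omega> \<in> space M"
  shows "sqrt (real T / (2 * real n))
    \<le> singular_value 1 (count_matrix n T X \<omega> - mean_count_matrix M n T X)"
proof -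
  let ?P = "bmc_matrix p n \<sigma>" and ?N = "mean_count_matrix M n T X"
  let ?A = "count_matrix n T X \<omega> - ?N"
  define q where "q = 1 / (c * real n)"
  have cn: "c * real n > 0" using c n by simp
  have mc: "markov_chain M n \<mu> ?P X" and st: "stationary_distribution n ?P \<mu>"
    and \<sigma>: "\<And>x. x < n \<Longrightarrow> \<sigma> x < K"
    and card: "\<And>k. k < K \<Longrightarrow> card (cluster n \<sigma> k) = cluster_size K \<alpha> n k"
    using bmc by (auto simp: block_markov_chain_def cluster_map_def)
  have P: "0 \<le> ?P $$ (x, y) \<and> ?P $$ (x, y) \<le> q" if "x < n" "y < n" for x y
    unfolding q_def using that p[OF \<sigma> \<sigma>, of x y] size[OF \<sigma>, of y] cn
    by (auto simp: bmc_matrix_def card[OF \<sigma>] intro!: frac_le)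
  have \<mu>: "0 \<le> \<mu> x \<and> \<mu> x \<le> q" if "x < n" for x
    using stationary_distribution_le[OF st _ that] P st that
    by (auto simp: stationary_distribution_def)
  have N: "?N $$ (x, y) \<le> 1 / 4" if "x < n" "y < n" for x y
  proof -
    have "?N $$ (x, y) = real T * (\<mu> x * ?P $$ (x, y))"
      using mean_count_matrix_entry[OF mc st that] by simp
    also have "\<dots> \<le> real T * (q * q)"
      using \<mu>[OF that(1)] P[OF that] by (intro mult_left_mono mult_mono) auto
    also have "\<dots> = real T / (c * real n)\<^sup>2" by (simp add: q_def power2_eq_square)
    also have "\<dots> \<le> 1 / 4" using T cn n by (subst pos_divide_le_eq) auto
    finally show ?thesis .
  qed
  have Nc: "?N \<in> carrier_mat n n" by (simp add: mean_count_matrix_def)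
  \<comment> \<open>the left-hand side is \<open>T / 2\<close>\<close>
  have "real T * (1 - 2 * (1 / 4)) \<le> (\<Sum>x<n. \<Sum>y<n. (?A $$ (x, y))\<^sup>2)"
    by (rule frobenius_count_minus_mean_ge[where X = X, OF _ Nc N])
      (rule markov_chain_less[OF mc \<omega>])
  hence "real T / (2 * real n) \<le> (\<Sum>x<n. \<Sum>y<n. (?A $$ (x, y))\<^sup>2) / real n"
    using n by (simp add: field_simps)
  moreover have "?A \<in> carrier_mat n n"
    using Nc by (intro minus_carrier_mat)
  ultimately show ?thesis
    using frobenius_le_singular_value_1[of ?A n] n real_sqrt_le_mono order_trans by blast
qed

section \<open>The lower bound on the largest singular value\<close>

theorem proposition2:
  fixes K :: nat and \<alpha> :: "nat \<Rightarrow> real" and p :: "real mat"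
    and T :: "nat \<Rightarrow> nat" and \<sigma> :: "nat \<Rightarrow> nat \<Rightarrow> nat" and \<mu> :: "nat \<Rightarrow> nat \<Rightarrow> real"
    and M :: "nat \<Rightarrow> 'a measure" and X :: "nat \<Rightarrow> nat \<Rightarrow> 'a \<Rightarrow> nat"
  assumes "K \<ge> 1"
    and "\<And>k. k < K \<Longrightarrow> \<alpha> k > 0"
    and "(\<Sum>k<K. \<alpha> k) = 1"
    and "p \<in> carrier_mat K K"
    and "\<And>k l. k < K \<Longrightarrow> l < K \<Longrightarrow> p $$ (k, l) > 0"
    and "\<And>k. k < K \<Longrightarrow> (\<Sum>l<K. p $$ (k, l)) = 1"
    and "vec_space.rank K p = K"
    and "\<And>n. (\<forall>k<K. cluster_size K \<alpha> n k > 0) \<Longrightarrow>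
               block_markov_chain K \<alpha> p n (\<sigma> n) (\<mu> n) (M n) (X n)"
    and "\<And>n. n \<ge> 1 \<Longrightarrow> T n > 0"
    and "filterlim (\<lambda>n. real (T n) / real n) at_top sequentially"
    and "(\<lambda>n. real (T n) / (real n)\<^sup>2) \<longlonglongrightarrow> 0"
  shows "(\<exists>b>0. \<exists>e>0. \<exists>n\<^sub>0\<ge>1. \<forall>n\<ge>n\<^sub>0.
            \<P>(\<omega> in M n. singular_value 1
                 (count_matrix n (T n) (X n) \<omega> - mean_count_matrix (M n) n (T n) (X n))
               > b * sqrt (real (T n) / real n))
            \<ge> 1 - exp (- e * (real (T n) / real n)))
       \<and> Omega_P M
           (\<lambda>n \<omega>. singular_value 1
              (count_matrix n (T n) (X n) \<omega> - mean_count_matrix (M n) n (T n) (X n)))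
           (\<lambda>n \<omega>. sqrt (real (T n) / real n))"
proof -
  let ?s = "\<lambda>n \<omega>. singular_value 1
    (count_matrix n (T n) (X n) \<omega> - mean_count_matrix (M n) n (T n) (X n))"
  let ?r = "\<lambda>n. sqrt (real (T n) / real n)"
  have p: "p $$ (k, l) \<in> {0..1}" if "k < K" "l < K" for k l
  proof -
    have "p $$ (k, l) \<le> (\<Sum>l<K. p $$ (k, l))"
      using that assms(5) by (intro member_le_sum) (auto simp: less_imp_le)
    thus ?thesis using that assms(5,6) by (simp add: less_imp_le)
  qed
  obtain c where c: "c > 0"
    "eventually (\<lambda>n. \<forall>k<K. c * real n \<le> real (cluster_size K \<alpha> n k)) sequentially"
    using cluster_size_linear_lower_bound[of K \<alpha>] assms(1-3) by blast
  have "eventually (\<lambda>n. real (T n) / (real n)\<^sup>2 < c\<^sup>2 / 4) sequentially"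
    using c(1) by (intro order_tendstoD(2)[OF assms(11)]) simp
  from eventually_conj[OF this c(2)] obtain n1 where n1: "\<And>n. n \<ge> n1 \<Longrightarrow>
      real (T n) / (real n)\<^sup>2 < c\<^sup>2 / 4 \<and> (\<forall>k<K. c * real n \<le> real (cluster_size K \<alpha> n k))"
    unfolding eventually_sequentially by blast
  define n0 where "n0 = max 1 n1"
  \<comment> \<open>the bound holds at every sample point; \<open>1 / 2\<close> instead of \<open>1 / sqrt 2\<close> makes it strict\<close>
  have big: "prob_space (M n) \<and> (\<forall>\<omega>\<in>space (M n). ?s n \<omega> > 1 / 2 * ?r n)" if "n \<ge> n0" for n
  proof -
    have n: "n > 0" "n \<ge> n1" using that by (auto simp: n0_def)
    have size: "c * real n \<le> real (cluster_size K \<alpha> n k)" if "k < K" for k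
      using n1[OF n(2)] that by blast
    have "\<forall>k<K. cluster_size K \<alpha> n k > 0"
    proof (intro allI impI)
      fix k assume "k < K"
      moreover have "c * real n > 0" using c(1) n(1) by simp
      ultimately have "real (cluster_size K \<alpha> n k) > 0" using size[of k] by linarith
      thus "cluster_size K \<alpha> n k > 0" by simp
    qed
    hence bmc: "block_markov_chain K \<alpha> p n (\<sigma> n) (\<mu> n) (M n) (X n)" by (rule assms(8))
    have "4 * real (T n) \<le> (c * real n)\<^sup>2"
      using n1[OF n(2)] n(1) by (simp add: field_simps)
    hence "sqrt (real (T n) / (2 * real n)) \<le> ?s n \<omega>" if "\<omega> \<in> space (M n)" for \<omega>
      using singular_value_count_minus_mean_ge[OF bmc n(1) p c(1) size _ that] by blast
    moreover have "1 / 2 * ?r n < sqrt (real (T n) / (2 * real n))"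
    proof -
      have "1 / 2 * ?r n = sqrt (real (T n) / (4 * real n))"
        by (simp add: real_sqrt_divide real_sqrt_mult)
      also have "\<dots> < sqrt (real (T n) / (2 * real n))"
        using n(1) assms(9)[of n] by (simp add: field_simps)
      finally show ?thesis .
    qed
    ultimately show ?thesis
      using bmc by (auto simp: block_markov_chain_def markov_chain_def intro: less_le_trans)
  qed
  \<comment> \<open>the event is the whole space, so any rate in the exponential works\<close>
  have "\<P>(\<omega> in M n. ?s n \<omega> > 1 / 2 * ?r n) \<ge> 1 - exp (- 1 * (real (T n) / real n))"
    if "n \<ge> n0" for n
  proof -
    interpret prob_space "M n" using big[OF that] by blast
    have "{\<omega> \<in> space (M n). ?s n \<omega> > 1 / 2 * ?r n} = space (M n)" using big[OF that] by blast
    thus ?thesis by (simp add: prob_space)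
  qed
  moreover have "\<P>(\<omega> in M n. \<bar>?s n \<omega>\<bar> < 1 / 2 * \<bar>?r n\<bar>) \<le> \<epsilon>"
    if "n > n0" "\<epsilon> > 0" for n and \<epsilon> :: real
  proof -
    have "\<not> \<bar>?s n \<omega>\<bar> < 1 / 2 * \<bar>?r n\<bar>" if "\<omega> \<in> space (M n)" for \<omega>
    proof -
      have "?s n \<omega> > 1 / 2 * ?r n" using big[of n] \<open>n > n0\<close> that by simp
      moreover have "?r n \<ge> 0" by simp
      ultimately show ?thesis by linarith
    qed
    hence "{\<omega> \<in> space (M n). \<bar>?s n \<omega>\<bar> < 1 / 2 * \<bar>?r n\<bar>} = {}" by blast
    hence "\<P>(\<omega> in M n. \<bar>?s n \<omega>\<bar> < 1 / 2 * \<bar>?r n\<bar>) = 0" by (simp only: measure_empty)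
    thus ?thesis using that(2) by simp
  qed
  moreover have "n0 \<ge> 1" by (simp add: n0_def)
  ultimately show ?thesis
    unfolding Omega_P_def
    by (intro conjI exI[of _ "1 / 2 :: real"] exI[of _ "1 :: real"] exI[of _ n0] allI impI) auto
qed

end
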